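(* In the setting described in the context (problem $\min F=f+r$, stochastic models satisfying (C1)–(C5)), for any $\alpha>0$ and corresponding constant stepsize $\eta_t = \frac{\alpha}{\sqrt{T+1}}$, the iterates of the stochastic model-based algorithm satisfy $$\mathbb{E}\left[F\left(\frac{1}{T+1}\sum_{t=0}^T x_t\right) - F(x^\ast)\right] \leq \frac{D_{\Phi}(x^\ast, x_0) + \frac{(\alpha\mathsf{L} )^2}{4} + \alpha( r(x_0) - \inf r)}{\alpha\sqrt{T+1}},$$ where $x^*$ is any minimizer of $F$ and $T>0$ is an integer.
   Context: Legendre functions. $\Phi\colon\mathbb{R}^d\to\mathbb{R}\cup\{\infty\}$ is a Legendre function: it is proper, closed, strictly convex; $U:=\mathrm{int}(\mathrm{dom}\,\Phi)$ is nonempty; $\Phi$ is differentiable on $U$; and $\|\nabla\Phi(x_k)\|\to\infty$ for any sequence $\{x_k\}\subset U$ converging to a boundary point of $\mathrm{dom}\,\Phi$. Its Bregman divergence is $D_\Phi(y,x)=\Phi(y)-\Phi(x)-\langle\nabla\Phi(x),y-x\rangle$ for $x\in U$ (equal to $+\infty$ if $y\notin\mathrm{dom}\,\Phi$). A function $g$ is $\mu$-strongly convex relative to $\Phi$ if $g-\mu\Phi$ is convex (for functions defined only on $U$: convex on $U$); $\mu=0$ is plain convexity. Problem. $\min_x F(x):=f(x)+r(x)$, where $f\colon\mathbb{R}^d\to\mathbb{R}$ is locally Lipschitz, $r\colon\mathbb{R}^d\to\mathbb{R}\cup\{\infty\}$ is closed with convex domain, and $\mathrm{ri}(\mathrm{dom}\,r)\subseteq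 U$ and $\partial(r+\Phi)(x)=\emptyset$ for all $x\notin U$. Here $\partial$ is the limiting subdifferential: $v\in\partial g(x)$ iff there are $x_k\to x$ with $g(x_k)\to g(x)$ and $v_k\to v$ with $v_k\in\hat\partial g(x_k)$, where $\hat\partial g(x)=\{v: g(y)\ge g(x)+\langle v,y-x\rangle+o(\|y-x\|)\text{ as }y\to x\}$. Assumptions. $(\Omega,\mathcal{F},P)$ is a probability space and: (C1) i.i.d. samples $\xi_0,\xi_1,\ldots\sim P$ can be generated. (C2) There is a measurable function $(x,y,\xi)\mapsto f_x(y,\xi)$ on $U\times U\times\Omega$ with $\mathbb{E}_\xi[f_x(x,\xi)]=f(x)$ for all $x\in U\cap\mathrm{dom}\,r$ and $\mathbb{E}_\xi[f_x(y,\xi)]\le f(y)$ for all $x,y\in U\cap\mathrm{dom}\,r$. (C3) There is $\mu\ge0$ such that $f_x(\cdot,\xi)+r(\cdot)$ is $\mu$-strongly convex relative to $\Phi$ for all $x\in U\cap\mathrm{dom}\,r$ and a.e. $\xi\in\Omega$. (C4) There are $\mathsf{L}>0$ and a square integrable $L\colon\Omega\to\mathbb{R}_+$ with $\sqrt{\mathbb{E}_\xi[L(\xi)^2]}\le\mathsf{L}$ and $f_x(x,\xi)-f_x(y,\xi)\le L(\xi)\sqrt{D_\Phi(y,x)}$ for all $x,y\in U\cap\mathrm{dom}\,r$. (C5) For every $\lambda>0$, $x\in U$ and a.e. $\xi$, the problems $\min_y\{F(y)+\frac1\lambda D_\Phi(y,x)\}$ and $\min_y\{f_x(y,\xi)+r(y)+\frac1\lambda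 D_\Phi(y,x)\}$ admit minimizers (unique and lying in $U$), varying measurably in $(x,\xi)\in U\times\Omega$. Minimization involving the models is over $y\in U$. Algorithm. Given $x_0\in U\cap\mathrm{dom}\,r$ and a nonincreasing sequence of step-sizes $\eta_t>0$: for $t=0,1,2,\ldots$, sample $\xi_t\sim P$ (independently) and set $x_{t+1}=\mathrm{argmin}_x\{f_{x_t}(x,\xi_t)+r(x)+\frac{1}{\eta_t}D_\Phi(x,x_t)\}$. *)

theory Defs
  imports "HOL-Probability.Probability"
begin

section \<open>Extended-real-valued functions\<close>

text \<open>Functions with values in \<open>\<real> \<union> {\<infinity>}\<close> are functions into \<^typ>\<open>ereal\<close> that never take
  the value \<open>-\<infinity>\<close>.\<close>

definition edom :: "('a \<Rightarrow> ereal) \<Rightarrow> 'a set" where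
  "edom g = {x. g x < \<infinity>}"

definition proper_fun :: "('a \<Rightarrow> ereal) \<Rightarrow> bool" where
  "proper_fun g \<longleftrightarrow> (\<forall>x. g x \<noteq> -\<infinity>) \<and> edom g \<noteq> {}"

definition closed_fun :: "('a::topological_space \<Rightarrow> ereal) \<Rightarrow> bool" where
  "closed_fun g \<longleftrightarrow> closed {(x, c::real). g x \<le> ereal c}"

definition econvex_on :: "'a::real_vector set \<Rightarrow> ('a \<Rightarrow> ereal) \<Rightarrow> bool" where
  "econvex_on S g \<longleftrightarrow> convex S \<and>
     (\<forall>x\<in>S. \<forall>y\<in>S. \<forall>u\<ge>0. \<forall>v\<ge>0. u + v = 1 \<longrightarrow>
        g (u *\<^sub>R x + v *\<^sub>R y) \<le> ereal u * g x + ereal v * g y)"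

definition strictly_econvex :: "('a::real_vector \<Rightarrow> ereal) \<Rightarrow> bool" where
  "strictly_econvex g \<longleftrightarrow>
     (\<forall>x\<in>edom g. \<forall>y\<in>edom g. \<forall>u>0. \<forall>v>0. x \<noteq> y \<longrightarrow> u + v = 1 \<longrightarrow>
        g (u *\<^sub>R x + v *\<^sub>R y) < ereal u * g x + ereal v * g y)"

definition unique_argmin_on :: "'a set \<Rightarrow> ('a \<Rightarrow> ereal) \<Rightarrow> 'a \<Rightarrow> bool" where
  "unique_argmin_on S g x \<longleftrightarrow>
     is_arg_min g (\<lambda>z. z \<in> S) x \<and> (\<forall>y. is_arg_min g (\<lambda>z. z \<in> S) y \<longrightarrow> y = x)"

definition locally_lipschitz :: "('a::metric_space \<Rightarrow> 'b::metric_space) \<Rightarrow> bool" where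
  "locally_lipschitz f \<longleftrightarrow> (\<forall>x. \<exists>e>0. \<exists>C. C-lipschitz_on (ball x e) f)"


section \<open>Limiting subdifferential\<close>

text \<open>By the usual convention, both subdifferentials are empty at points where the function
  is not finite. The term \<open>o(\<parallel>y - x\<parallel>)\<close> is spelled out with an \<open>\<epsilon>\<close>.\<close>

definition frechet_subdiff :: "('a::real_inner \<Rightarrow> ereal) \<Rightarrow> 'a \<Rightarrow> 'a set" where
  "frechet_subdiff g x =
     {v. \<bar>g x\<bar> \<noteq> \<infinity> \<and>
         (\<forall>\<epsilon>>0. \<forall>\<^sub>F y in at x. g y \<ge> g x + ereal (v \<bullet> (y - x) - \<epsilon> * norm (y - x)))}"

definition limiting_subdiff :: "('a::real_inner \<Rightarrow> ereal) \<Rightarrow> 'a \<Rightarrow> 'a set" where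
  "limiting_subdiff g x =
     {v. \<bar>g x\<bar> \<noteq> \<infinity> \<and>
         (\<exists>(X :: nat \<Rightarrow> 'a) V. X \<longlonglongrightarrow> x \<and> (\<lambda>k. g (X k)) \<longlonglongrightarrow> g x \<and> V \<longlonglongrightarrow> v \<and>
            (\<forall>k. V k \<in> frechet_subdiff g (X k)))}"


section \<open>Legendre functions and Bregman divergences\<close>

definition gradient :: "('a::real_inner \<Rightarrow> ereal) \<Rightarrow> 'a \<Rightarrow> 'a" where
  "gradient \<Phi> x = (THE v. GDERIV (\<lambda>y. real_of_ereal (\<Phi> y)) x :> v)"

abbreviation int_dom :: "('a::topological_space \<Rightarrow> ereal) \<Rightarrow> 'a set" where
  "int_dom \<Phi> \<equiv> interior (edom \<Phi>)"

definition legendre :: "('a::euclidean_space \<Rightarrow> ereal) \<Rightarrow> bool" where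
  "legendre \<Phi> \<longleftrightarrow>
     proper_fun \<Phi> \<and> closed_fun \<Phi> \<and> strictly_econvex \<Phi> \<and> int_dom \<Phi> \<noteq> {} \<and>
     (\<forall>x\<in>int_dom \<Phi>. (\<lambda>y. real_of_ereal (\<Phi> y)) differentiable (at x)) \<and>
     (\<forall>X z. (\<forall>k::nat. X k \<in> int_dom \<Phi>) \<longrightarrow> X \<longlonglongrightarrow> z \<longrightarrow> z \<in> frontier (edom \<Phi>) \<longrightarrow>
        filterlim (\<lambda>k. norm (gradient \<Phi> (X k))) at_top sequentially)"

text \<open>For \<open>x\<close> in the interior of the domain, where \<open>\<Phi> x\<close> is finite, the value is \<open>\<infinity>\<close>
  whenever \<open>\<Phi> y = \<infinity>\<close>.\<close>

definition bregman :: "('a::real_inner \<Rightarrow> ereal) \<Rightarrow> 'a \<Rightarrow> 'a \<Rightarrow> ereal" where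
  "bregman \<Phi> y x = \<Phi> y - \<Phi> x - ereal (gradient \<Phi> x \<bullet> (y - x))"

text \<open>Only used for \<open>S\<close> on which \<open>\<Phi>\<close> is finite, so that the difference is unproblematic.\<close>

definition rel_strongly_convex_on ::
    "'a::real_vector set \<Rightarrow> ('a \<Rightarrow> ereal) \<Rightarrow> real \<Rightarrow> ('a \<Rightarrow> ereal) \<Rightarrow> bool" where
  "rel_strongly_convex_on S \<Phi> \<mu> g \<longleftrightarrow> econvex_on S (\<lambda>y. g y - ereal \<mu> * \<Phi> y)"


section \<open>The optimization problem and its stochastic models\<close>

definition objective :: "('a \<Rightarrow> real) \<Rightarrow> ('a \<Rightarrow> ereal) \<Rightarrow> 'a \<Rightarrow> ereal" where
  "objective f r x = ereal (f x) + r x"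

locale composite_problem =
  fixes \<Phi> :: "'a::euclidean_space \<Rightarrow> ereal"
    and f :: "'a \<Rightarrow> real"
    and r :: "'a \<Rightarrow> ereal"
  assumes legendre: "legendre \<Phi>"
    and f_locally_lipschitz: "locally_lipschitz f"
    and r_not_MInf: "\<And>x. r x \<noteq> -\<infinity>"
    and r_closed: "closed_fun r"
    and convex_dom_r: "convex (edom r)"
    and ri_dom_r: "rel_interior (edom r) \<subseteq> int_dom \<Phi>"
    and subdiff_empty: "\<And>x. x \<notin> int_dom \<Phi> \<Longrightarrow> limiting_subdiff (\<lambda>y. r y + \<Phi> y) x = {}"

text \<open>The number \<open>model x y s\<close> is \<open>f\<^sub>x(y, s)\<close>; only its values for \<open>x, y\<close> in \<open>int_dom \<Phi>\<close>
  matter. The function \<open>argmin_model \<lambda>\<close> is the measurable solution map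
  \<open>(x, s) \<mapsto> argmin\<^sub>y {f\<^sub>x(y, s) + r(y) + D\<^sub>\<Phi>(y, x) / \<lambda>}\<close>. For each \<open>x\<close> it is
  determined only up to a null set of samples \<open>s\<close>, on which its value is arbitrary.

  Integrability of \<open>f\<^sub>x(y, \<cdot>)\<close> is part of the meaning of the expectations in
  \<open>model_unbiased\<close> and \<open>model_underestimates\<close>; the Bochner integral of a
  non-integrable function would be \<open>0\<close>. In the inequality this loses nothing, since
  \<open>f\<^sub>x(y, \<cdot>)\<close> has an integrable lower bound by \<open>model_lipschitz\<close>.\<close>

locale stochastic_models =
  composite_problem \<Phi> f r + prob_space P
  for \<Phi> :: "'a::euclidean_space \<Rightarrow> ereal"
    and f :: "'a \<Rightarrow> real"
    and r :: "'a \<Rightarrow> ereal"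
    and P :: "'b measure" +
  fixes model :: "'a \<Rightarrow> 'a \<Rightarrow> 'b \<Rightarrow> real"
    and \<mu> :: real
    and lip :: "'b \<Rightarrow> real"
    and \<L> :: real
    and argmin_model :: "real \<Rightarrow> 'a \<Rightarrow> 'b \<Rightarrow> 'a"
  assumes model_measurable:
      "(\<lambda>(x, y, s). model x y s) \<in> borel_measurable
         (restrict_space borel (int_dom \<Phi>) \<Otimes>\<^sub>M (restrict_space borel (int_dom \<Phi>) \<Otimes>\<^sub>M P))"
    and model_unbiased:
      "\<And>x. x \<in> int_dom \<Phi> \<inter> edom r \<Longrightarrow>
         integrable P (model x x) \<and> (\<integral>s. model x x s \<partial>P) = f x"
    and model_underestimates:
      "\<And>x y. x \<in> int_dom \<Phi> \<inter> edom r \<Longrightarrow> y \<in> int_dom \<Phi> \<inter> edom r \<Longrightarrow>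
         integrable P (model x y) \<and> (\<integral>s. model x y s \<partial>P) \<le> f y"
    and \<mu>_nonneg: "\<mu> \<ge> 0"
    and model_convex:
      "\<And>x. x \<in> int_dom \<Phi> \<inter> edom r \<Longrightarrow>
         AE s in P. rel_strongly_convex_on (int_dom \<Phi>) \<Phi> \<mu> (\<lambda>y. ereal (model x y s) + r y)"
    and \<L>_pos: "\<L> > 0"
    and lip_nonneg: "\<And>s. s \<in> space P \<Longrightarrow> lip s \<ge> 0"
    and lip_measurable: "lip \<in> borel_measurable P"
    and lip_square_integrable: "integrable P (\<lambda>s. (lip s)\<^sup>2)"
    and lip_bound: "sqrt (\<integral>s. (lip s)\<^sup>2 \<partial>P) \<le> \<L>"
    and model_lipschitz:
      "\<And>x. x \<in> int_dom \<Phi> \<inter> edom r \<Longrightarrow>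
         AE s in P. \<forall>y \<in> int_dom \<Phi> \<inter> edom r.
           model x x s - model x y s \<le> lip s * sqrt (real_of_ereal (bregman \<Phi> y x))"
    and prox_objective:
      "\<And>l. l > 0 \<Longrightarrow>
         \<exists>p \<in> restrict_space borel (int_dom \<Phi>) \<rightarrow>\<^sub>M restrict_space borel (int_dom \<Phi>).
           \<forall>x \<in> int_dom \<Phi>.
             unique_argmin_on UNIV (\<lambda>y. objective f r y + ereal (1 / l) * bregman \<Phi> y x) (p x)"
    and argmin_model_measurable:
      "\<And>l. l > 0 \<Longrightarrow>
         (\<lambda>(x, s). argmin_model l x s) \<in>
           restrict_space borel (int_dom \<Phi>) \<Otimes>\<^sub>M P \<rightarrow>\<^sub>M restrict_space borel (int_dom \<Phi>)"
    and argmin_model: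
      "\<And>l x. l > 0 \<Longrightarrow> x \<in> int_dom \<Phi> \<Longrightarrow>
         AE s in P. unique_argmin_on (int_dom \<Phi>)
           (\<lambda>y. ereal (model x y s) + r y + ereal (1 / l) * bregman \<Phi> y x) (argmin_model l x s)"

text \<open>The iterates \<open>x\<^sub>t\<^sub>+\<^sub>1 = argmin\<^sub>x {f\<^bsub>x\<^sub>t\<^esub>(x, s\<^sub>t) + r(x) + D\<^sub>\<Phi>(x, x\<^sub>t) / \<eta>\<^sub>t}\<close> along a sequence of
  samples \<open>s\<close>, for a solution map as in \<^locale>\<open>stochastic_models\<close>.\<close>

primrec model_iterates ::
    "(real \<Rightarrow> 'a \<Rightarrow> 'b \<Rightarrow> 'a) \<Rightarrow> (nat \<Rightarrow> real) \<Rightarrow> 'a \<Rightarrow> (nat \<Rightarrow> 'b) \<Rightarrow> nat \<Rightarrow> 'a" where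
  "model_iterates argmin_model \<eta> x\<^sub>0 s 0 = x\<^sub>0"
| "model_iterates argmin_model \<eta> x\<^sub>0 s (Suc t) =
     argmin_model (\<eta> t) (model_iterates argmin_model \<eta> x\<^sub>0 s t) (s t)"

text \<open>The expectation of an extended-real random variable that is nonnegative, such as
  \<open>F(\<cdot>) - F(x\<^sup>*)\<close> for a minimizer \<open>x\<^sup>*\<close> of \<open>F\<close>. It always exists in \<open>[0, \<infinity>]\<close>.
  The function \<^const>\<open>e2ennreal\<close> would truncate negative values to \<open>0\<close>.\<close>

definition expectation_nonneg :: "'w measure \<Rightarrow> ('w \<Rightarrow> ereal) \<Rightarrow> ereal" where
  "expectation_nonneg M Z = enn2ereal (\<integral>\<^sup>+\<omega>. e2ennreal (Z \<omega>) \<partial>M)"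

end

theory Submission
  imports Defs
begin

text \<open>
  Write \<open>F = f + r\<close>, \<open>D\<close> for the Bregman divergence, \<open>l = \<alpha> / sqrt (T + 1)\<close> for the step-size
  and \<open>\<rho> = inf r\<close>.

  One step of the algorithm minimizes a convex function plus \<open>D(\<cdot>, x\<^sub>t) / l\<close>, and first-order
  optimality gives the three-point inequality (\<open>three_point_inequality\<close>). The Lipschitz
  property of the models replaces \<open>f\<^bsub>x\<^sub>t\<^esub>(x\<^sub>t\<^sub>+\<^sub>1, s)\<close> by \<open>f\<^bsub>x\<^sub>t\<^esub>(x\<^sub>t, s)\<close> at the price of
  \<open>L(s) sqrt (D(x\<^sub>t\<^sub>+\<^sub>1, x\<^sub>t))\<close>, which Young's inequality absorbs into the term
  \<open>D(x\<^sub>t\<^sub>+\<^sub>1, x\<^sub>t)\<close> of the three-point inequality (\<open>model_step\<close>). Averaging over the sample, the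
  function \<open>V(x) = D(y, x) + l (r(x) - \<rho>)\<close> satisfies
  \<open>E V(x\<^sub>t\<^sub>+\<^sub>1) + l (F(x\<^sub>t) - min F) \<le> V(x\<^sub>t) + l\<^sup>2 \<L>\<^sup>2 / 4 + l (F(y) - min F)\<close>
  (\<open>lyapunov_descent\<close>). The summand \<open>l (r - \<rho>)\<close> of \<open>V\<close> corrects for the step controlling
  \<open>f(x\<^sub>t) + r(x\<^sub>t\<^sub>+\<^sub>1)\<close> instead of \<open>F(x\<^sub>t)\<close>; it produces the term \<open>r(x\<^sub>0) - inf r\<close> of the bound.
  All terms are nonnegative, so they can be handled as \<^typ>\<open>ennreal\<close>-valued functions without
  any integrability argument for the iterates, and points with \<open>r = \<infinity>\<close> need no separate
  almost-sure statement because there both sides are infinite. Telescoping is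
  \<open>gap_sum_le_lyapunov\<close>, and Jensen's inequality passes to the averaged iterate.

  Two points deserve attention. First, \<open>F\<close> is not assumed convex. It is convex on
  \<open>int_dom \<Phi> \<inter> edom r\<close> because the model centred at a point \<open>z\<close> is convex, has
  mean \<open>f(z)\<close> at \<open>z\<close> and mean at most \<open>f\<close> at the other points of this set (\<open>objective_convex_on\<close>). Second, the
  three-point inequality compares only with points \<open>y\<close> of \<open>int_dom \<Phi>\<close>, whereas the minimizer
  \<open>x\<^sup>*\<close> may lie on the boundary of the domain, where no continuity of \<open>F\<close> is assumed. The comparison
  points are therefore the proximal points \<open>y\<close> of \<open>F\<close> at \<open>x\<^sub>0\<close> with a large parameter: since \<open>x\<^sup>*\<close> minimizes
  \<open>F\<close>, they satisfy \<open>D(y, x\<^sub>0) \<le> D(x\<^sup>*, x\<^sub>0)\<close>, while \<open>F(y)\<close> tends to \<open>F(x\<^sup>*)\<close>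
  (\<open>feasible_approximate_minimizer\<close>). If \<open>D(x\<^sup>*, x\<^sub>0)\<close> or \<open>-inf r\<close> is infinite, so is the bound.
\<close>

section \<open>Legendre functions and the three-point inequality\<close>

abbreviation (input) finite_part :: "('a \<Rightarrow> ereal) \<Rightarrow> 'a \<Rightarrow> real" where
  "finite_part g \<equiv> \<lambda>y. real_of_ereal (g y)"

text \<open>A function with closed epigraph has closed sublevel sets.\<close>
lemma closed_fun_measurable:
  fixes g :: "'a::topological_space \<Rightarrow> ereal"
  assumes "closed_fun g"
  shows "g \<in> borel_measurable borel"
proof (rule borel_measurableI_le)
  fix c :: ereal
  have lev: "{x. g x \<le> ereal a} \<in> sets borel" for a
  proof -
    have "closed ((\<lambda>x. (x, a)) -` {(x, c::real). g x \<le> ereal c})"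
      using assms unfolding closed_fun_def
      by (intro closed_vimage) (auto intro!: continuous_intros)
    then show ?thesis by (simp add: vimage_def)
  qed
  have "{x. g x \<le> c} \<in> sets borel"
  proof (cases c)
    case MInf
    have "{x. g x \<le> c} = (\<Inter>n::nat. {x. g x \<le> ereal (- real n)})"
    proof (intro equalityI subsetI)
      fix x assume "x \<in> (\<Inter>n::nat. {x. g x \<le> ereal (- real n)})"
      then have *: "g x \<le> ereal (- real n)" for n by auto
      have "g x \<le> ereal b" for b
        using order_trans[OF *[of "nat \<lceil>-b\<rceil>"], of "ereal b"]
        by (smt (verit) ereal_less_eq(3) real_nat_ceiling_ge)
      then show "x \<in> {x. g x \<le> c}"
        using MInf by (simp add: ereal_bot)
    qed (use MInf in auto)
    then show ?thesis using lev by auto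
  qed (use lev in auto)
  then show "{x \<in> space borel. g x \<le> c} \<in> sets borel" by simp
qed

lemma finite_part_eq:
  assumes "\<And>x. g x \<noteq> -\<infinity>" "x \<in> edom g"
  shows "g x = ereal (finite_part g x)"
  using assms by (cases "g x") (auto simp: edom_def dest: spec[of _ x])

lemma legendre_finite:
  assumes "legendre \<Phi>" "x \<in> edom \<Phi>"
  shows "\<Phi> x = ereal (finite_part \<Phi> x)"
  using assms by (intro finite_part_eq) (auto simp: legendre_def proper_fun_def)

lemma legendre_convex_on:
  assumes "legendre \<Phi>"
  shows "convex_on (edom \<Phi>) (finite_part \<Phi>)"
proof -
  have main: "(1 - t) *\<^sub>R x + t *\<^sub>R y \<in> edom \<Phi> \<and>
      finite_part \<Phi> ((1 - t) *\<^sub>R x + t *\<^sub>R y) \<le> (1 - t) * finite_part \<Phi> x + t * finite_part \<Phi> y"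
    if t: "0 < t" "t < 1" and x: "x \<in> edom \<Phi>" and y: "y \<in> edom \<Phi>" for t x y
  proof (cases "x = y")
    case True
    then show ?thesis using x by (simp add: algebra_simps flip: scaleR_left_distrib)
  next
    case False
    let ?z = "(1 - t) *\<^sub>R x + t *\<^sub>R y"
    have "\<Phi> ?z < ereal (1 - t) * \<Phi> x + ereal t * \<Phi> y"
      using assms False t x y unfolding legendre_def strictly_econvex_def by auto
    also have "\<dots> = ereal ((1 - t) * finite_part \<Phi> x + t * finite_part \<Phi> y)"
      using legendre_finite[OF assms x] legendre_finite[OF assms y]
      by (metis plus_ereal.simps(1) times_ereal.simps(1))
    finally have less: "\<Phi> ?z < ereal ((1 - t) * finite_part \<Phi> x + t * finite_part \<Phi> y)" .
    then have z: "?z \<in> edom \<Phi>" unfolding edom_def by auto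
    show ?thesis using less z legendre_finite[OF assms z]
      by (metis ereal_less_eq(3) less_imp_le)
  qed
  show ?thesis
  proof (rule convex_onI)
    show "convex (edom \<Phi>)"
      unfolding convex_alt
    proof (intro ballI allI impI)
      fix x y u assume "x \<in> edom \<Phi>" "y \<in> edom \<Phi>" and "0 \<le> u \<and> u \<le> (1::real)"
      then show "(1 - u) *\<^sub>R x + u *\<^sub>R y \<in> edom \<Phi>"
        using main[of u x y] by (cases "u = 0 \<or> u = 1") auto
    qed
  qed (use main in blast)
qed

lemma legendre_gderiv:
  assumes "legendre \<Phi>" "x \<in> int_dom \<Phi>"
  shows "GDERIV (finite_part \<Phi>) x :> gradient \<Phi> x"
proof -
  obtain D where D: "(finite_part \<Phi> has_derivative D) (at x)"
    using assms unfolding legendre_def differentiable_def by blast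
  interpret D: bounded_linear D using has_derivative_bounded_linear[OF D] .
  define v where "v = (\<Sum>b\<in>Basis. D b *\<^sub>R b)"
  have "D h = h \<bullet> v" for h
  proof -
    have "D h = D (\<Sum>b\<in>Basis. (h \<bullet> b) *\<^sub>R b)" by (simp add: euclidean_representation)
    also have "\<dots> = h \<bullet> v"
      by (simp add: D.sum D.scaleR v_def inner_sum_right mult.commute)
    finally show ?thesis .
  qed
  then have "D = (\<lambda>h. h \<bullet> v)" by auto
  with D have v: "GDERIV (finite_part \<Phi>) x :> v" by (simp add: gderiv_def)
  show ?thesis unfolding gradient_def
  proof (rule theI[where a = v])
    show "GDERIV (finite_part \<Phi>) x :> v" by (rule v)
    fix w assume "GDERIV (finite_part \<Phi>) x :> w"
    then have "(\<lambda>h. h \<bullet> w) = (\<lambda>h. h \<bullet> v)"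
      using v has_derivative_unique unfolding gderiv_def by blast
    then have "(w - v) \<bullet> w = (w - v) \<bullet> v" by metis
    then have "(w - v) \<bullet> (w - v) = 0" by (simp add: inner_diff_right)
    then show "w = v" by simp
  qed
qed

text \<open>The three results that use the gradient (nonnegativity and measurability of the divergence,
  and the three-point inequality) all do so through one-sided difference quotients.\<close>
lemma legendre_directional_derivative:
  assumes "legendre \<Phi>" "x \<in> int_dom \<Phi>"
  shows "((\<lambda>s. (finite_part \<Phi> (x + s *\<^sub>R d) - finite_part \<Phi> x) / s) \<longlongrightarrow> gradient \<Phi> x \<bullet> d) (at 0)"
proof -
  have "((\<lambda>s. x + s *\<^sub>R d) has_derivative (\<lambda>s. s *\<^sub>R d)) (at (0::real))"
    by (auto intro!: derivative_eq_intros)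
  moreover have "(finite_part \<Phi> has_derivative (\<lambda>h. h \<bullet> gradient \<Phi> x)) (at (x + 0 *\<^sub>R d))"
    using legendre_gderiv[OF assms] by (simp add: gderiv_def)
  ultimately have "((\<lambda>s. finite_part \<Phi> (x + s *\<^sub>R d)) has_derivative (\<lambda>s. (s *\<^sub>R d) \<bullet> gradient \<Phi> x)) (at (0::real))"
    by (rule has_derivative_compose)
  then have "((\<lambda>s. finite_part \<Phi> (x + s *\<^sub>R d)) has_real_derivative gradient \<Phi> x \<bullet> d) (at 0)"
    by (simp add: has_field_derivative_def inner_commute mult_commute_abs)
  then show ?thesis by (simp add: DERIV_def)
qed

definition real_bregman :: "('a::real_inner \<Rightarrow> ereal) \<Rightarrow> 'a \<Rightarrow> 'a \<Rightarrow> real" where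
  "real_bregman \<Phi> y x = finite_part \<Phi> y - finite_part \<Phi> x - gradient \<Phi> x \<bullet> (y - x)"

lemma bregman_eq_real_bregman:
  assumes "legendre \<Phi>" "y \<in> edom \<Phi>" "x \<in> edom \<Phi>"
  shows "bregman \<Phi> y x = ereal (real_bregman \<Phi> y x)"
  using legendre_finite[OF assms(1,2)] legendre_finite[OF assms(1,3)]
  unfolding bregman_def real_bregman_def by (metis ereal_minus(1))

lemma bregman_eq_infinity:
  assumes "legendre \<Phi>" "y \<notin> edom \<Phi>" "x \<in> edom \<Phi>"
  shows "bregman \<Phi> y x = \<infinity>"
proof -
  have "\<Phi> y = \<infinity>" using assms(2) by (simp add: edom_def)
  with legendre_finite[OF assms(1,3)] show ?thesis unfolding bregman_def
    by (cases "\<Phi> x") auto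
qed

lemma lower_bound_limit_at_0:
  fixes q :: "real \<Rightarrow> real"
  assumes "(q \<longlongrightarrow> L) (at 0)" and "\<And>s. 0 < s \<Longrightarrow> s < 1 \<Longrightarrow> c \<le> q s"
  shows "c \<le> L"
proof (rule tendsto_lowerbound)
  show "(q \<longlongrightarrow> L) (at_right 0)" using assms(1) by (rule tendsto_mono[rotated]) (simp add: at_le)
  show "\<forall>\<^sub>F s in at_right 0. c \<le> q s"
    unfolding eventually_at_right_field using assms(2) by (intro exI[of _ 1]) auto
qed simp

lemma real_bregman_nonneg:
  assumes "legendre \<Phi>" "y \<in> edom \<Phi>" "x \<in> int_dom \<Phi>"
  shows "0 \<le> real_bregman \<Phi> y x"
proof -
  have x: "x \<in> edom \<Phi>" using assms(3) interior_subset by blast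
  have "- (finite_part \<Phi> y - finite_part \<Phi> x) \<le> - (gradient \<Phi> x \<bullet> (y - x))"
  proof (rule lower_bound_limit_at_0)
    show "((\<lambda>s. - ((finite_part \<Phi> (x + s *\<^sub>R (y - x)) - finite_part \<Phi> x) / s)) \<longlongrightarrow> - (gradient \<Phi> x \<bullet> (y - x))) (at 0)"
      by (intro tendsto_minus legendre_directional_derivative assms)
    fix s :: real assume s: "0 < s" "s < 1"
    have "finite_part \<Phi> ((1 - s) *\<^sub>R x + s *\<^sub>R y) \<le> (1 - s) * finite_part \<Phi> x + s * finite_part \<Phi> y"
      using convex_onD[OF legendre_convex_on[OF assms(1)], of s x y] s x assms(2) by simp
    moreover have "(1 - s) *\<^sub>R x + s *\<^sub>R y = x + s *\<^sub>R (y - x)" by (simp add: algebra_simps)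
    ultimately have "finite_part \<Phi> (x + s *\<^sub>R (y - x)) - finite_part \<Phi> x \<le> s * (finite_part \<Phi> y - finite_part \<Phi> x)"
      by (simp add: algebra_simps)
    then have "(finite_part \<Phi> (x + s *\<^sub>R (y - x)) - finite_part \<Phi> x) / s \<le> finite_part \<Phi> y - finite_part \<Phi> x"
      using s by (simp add: divide_le_eq mult.commute)
    then show "- (finite_part \<Phi> y - finite_part \<Phi> x) \<le> - ((finite_part \<Phi> (x + s *\<^sub>R (y - x)) - finite_part \<Phi> x) / s)"
      by simp
  qed
  then show ?thesis by (simp add: real_bregman_def)
qed

text \<open>The gradient is a pointwise limit of difference quotients of the Borel function \<open>\<Phi>\<close>, hence
  Borel on \<open>int_dom \<Phi>\<close>.\<close>
lemma real_bregman_measurable: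
  fixes \<Phi> :: "'a::euclidean_space \<Rightarrow> ereal"
  assumes "legendre \<Phi>"
  shows "real_bregman \<Phi> y \<in> borel_measurable (restrict_space borel (int_dom \<Phi>))"
proof -
  let ?N = "restrict_space borel (int_dom \<Phi>)"
  have [measurable]: "\<Phi> \<in> borel_measurable borel"
    using assms by (intro closed_fun_measurable) (simp add: legendre_def)
  have id: "(\<lambda>x. x) \<in> ?N \<rightarrow>\<^sub>M borel" by (simp add: measurable_restrict_space1)
  have "(\<lambda>x. gradient \<Phi> x \<bullet> b) \<in> borel_measurable ?N" for b
  proof (rule borel_measurable_LIMSEQ_real)
    let ?h = "\<lambda>n. inverse (real (Suc n))"
    show "(\<lambda>n. (finite_part \<Phi> (x + ?h n *\<^sub>R b) - finite_part \<Phi> x) / ?h n) \<longlonglongrightarrow> gradient \<Phi> x \<bullet> b"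
      if "x \<in> space ?N" for x
    proof (rule filterlim_compose[OF legendre_directional_derivative[OF assms]])
      show "x \<in> int_dom \<Phi>" using that by (simp add: space_restrict_space)
      show "filterlim ?h (at 0) sequentially"
        unfolding filterlim_at using LIMSEQ_inverse_real_of_nat by auto
    qed
    show "(\<lambda>x. (finite_part \<Phi> (x + ?h n *\<^sub>R b) - finite_part \<Phi> x) / ?h n) \<in> borel_measurable ?N" for n
      by (rule measurable_restrict_space1) measurable
  qed
  then have "gradient \<Phi> \<in> borel_measurable ?N"
    by (subst borel_measurable_euclidean_space) simp
  note [measurable] = this id
  have [measurable]: "finite_part \<Phi> \<in> borel_measurable ?N"
    by (rule measurable_restrict_space1) measurable
  show ?thesis unfolding real_bregman_def by measurable
qed

text \<open>Comparing \<open>p\<close> with the points \<open>p + s (y - p)\<close> and letting \<open>s\<close> tend to \<open>0\<close> gives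
  \<open>l (h y - h p) + (\<nabla>\<Phi>(p) - \<nabla>\<Phi>(x)) \<bullet> (y - p) \<ge> 0\<close>; the inner product equals
  \<open>D(y, x) - D(p, x) - D(y, p)\<close>.\<close>
lemma three_point_inequality:
  assumes "legendre \<Phi>" and C: "C \<subseteq> int_dom \<Phi>" and h: "convex_on C h" and "0 < l"
    and "x \<in> int_dom \<Phi>" "p \<in> C" "y \<in> C"
    and min: "\<And>z. z \<in> C \<Longrightarrow> h p + real_bregman \<Phi> p x / l \<le> h z + real_bregman \<Phi> z x / l"
  shows "l * h p + real_bregman \<Phi> p x + real_bregman \<Phi> y p \<le> l * h y + real_bregman \<Phi> y x"
proof -
  let ?\<phi> = "finite_part \<Phi>"
  let ?d = "y - p"
  have p: "p \<in> int_dom \<Phi>" using assms by auto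
  have "gradient \<Phi> x \<bullet> ?d - l * (h y - h p) \<le> gradient \<Phi> p \<bullet> ?d"
  proof (rule lower_bound_limit_at_0[OF legendre_directional_derivative[OF assms(1) p]])
    fix s :: real assume s: "0 < s" "s < 1"
    have eq: "(1 - s) *\<^sub>R p + s *\<^sub>R y = p + s *\<^sub>R ?d" by (simp add: algebra_simps)
    have z: "p + s *\<^sub>R ?d \<in> C"
      using convexD_alt[OF convex_on_imp_convex[OF h] assms(6,7), of s] s eq by simp
    have "h (p + s *\<^sub>R ?d) \<le> (1 - s) * h p + s * h y"
      using convex_onD[OF h, of s p y] s assms(6,7) eq by simp
    then have "h p + real_bregman \<Phi> p x / l \<le> (1 - s) * h p + s * h y + real_bregman \<Phi> (p + s *\<^sub>R ?d) x / l"
      using min[OF z] by simp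
    then have "0 \<le> s * (h y - h p) + (real_bregman \<Phi> (p + s *\<^sub>R ?d) x - real_bregman \<Phi> p x) / l"
      by (simp add: algebra_simps diff_divide_distrib)
    then have "0 \<le> l * (s * (h y - h p)) + (real_bregman \<Phi> (p + s *\<^sub>R ?d) x - real_bregman \<Phi> p x)"
      using \<open>0 < l\<close> by (simp add: field_simps)
    also have "real_bregman \<Phi> (p + s *\<^sub>R ?d) x - real_bregman \<Phi> p x
        = ?\<phi> (p + s *\<^sub>R ?d) - ?\<phi> p - s * (gradient \<Phi> x \<bullet> ?d)"
      by (simp add: real_bregman_def inner_diff_right inner_add_right algebra_simps)
    finally have "s * (gradient \<Phi> x \<bullet> ?d - l * (h y - h p)) \<le> ?\<phi> (p + s *\<^sub>R ?d) - ?\<phi> p"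
      by (simp add: algebra_simps)
    then show "gradient \<Phi> x \<bullet> ?d - l * (h y - h p) \<le> (?\<phi> (p + s *\<^sub>R ?d) - ?\<phi> p) / s"
      using s by (simp add: le_divide_eq mult.commute)
  qed
  then show ?thesis
    by (simp add: real_bregman_def inner_diff_right algebra_simps)
qed

section \<open>Iterates driven by independent samples\<close>

text \<open>The index set \<open>A\<close> is \<open>UNIV\<close> when the measurability of the iterates is concerned, and
  \<open>{..<t}\<close> when their independence of the sample \<open>t\<close> is.\<close>
lemma measurable_model_iterates:
  assumes K: "(\<lambda>(x, s). argmin_model l x s) \<in> N \<Otimes>\<^sub>M P \<rightarrow>\<^sub>M N" and "x\<^sub>0 \<in> space N" and "{..<t} \<subseteq> A"
  shows "(\<lambda>s. model_iterates argmin_model (\<lambda>_. l) x\<^sub>0 s t) \<in> PiM A (\<lambda>_. P) \<rightarrow>\<^sub>M N"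
  using \<open>{..<t} \<subseteq> A\<close>
proof (induction t)
  case (Suc t)
  have "(\<lambda>s. (model_iterates argmin_model (\<lambda>_. l) x\<^sub>0 s t, s t)) \<in> PiM A (\<lambda>_. P) \<rightarrow>\<^sub>M N \<Otimes>\<^sub>M P"
    using Suc by (intro measurable_Pair measurable_component_singleton Suc.IH) auto
  from measurable_compose[OF this K] show ?case by simp
qed (use assms in simp)

lemma model_iterates_cong:
  "(\<And>i. i < t \<Longrightarrow> s i = s' i) \<Longrightarrow>
    model_iterates argmin_model \<eta> x\<^sub>0 s t = model_iterates argmin_model \<eta> x\<^sub>0 s' t"
  by (induction t) auto

text \<open>The iterate \<open>x t\<close> is a function of \<open>\<xi> i\<close> for \<open>i < t\<close> and thus independent of \<open>\<xi> t\<close>. Hence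
  \<open>(x t, \<xi> t)\<close> is distributed according to a product measure, and Tonelli's theorem
  integrates out the last sample.\<close>
lemma nn_integral_model_iterates_Suc:
  assumes "prob_space M" and indep: "prob_space.indep_vars M (\<lambda>_. P) \<xi> UNIV"
    and distr: "\<And>t. distr M P (\<xi> t) = P"
    and K: "(\<lambda>(x, s). argmin_model l x s) \<in> N \<Otimes>\<^sub>M P \<rightarrow>\<^sub>M N" and "x\<^sub>0 \<in> space N"
    and h: "h \<in> borel_measurable N"
    and x_def: "\<And>t \<omega>. x t \<omega> = model_iterates argmin_model (\<lambda>_. l) x\<^sub>0 (\<lambda>i. \<xi> i \<omega>) t"
  shows "(\<integral>\<^sup>+\<omega>. h (x (Suc t) \<omega>) \<partial>M) = (\<integral>\<^sup>+\<omega>. (\<integral>\<^sup>+s. h (argmin_model l (x t \<omega>) s) \<partial>P) \<partial>M)"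
    and "x t \<in> M \<rightarrow>\<^sub>M N"
proof -
  interpret M: prob_space M by fact
  have rv: "\<xi> i \<in> M \<rightarrow>\<^sub>M P" for i using indep by (simp add: M.indep_vars_def)
  interpret P: prob_space P using M.prob_space_distr[OF rv[of 0]] distr by simp
  let ?G = "\<lambda>s. model_iterates argmin_model (\<lambda>_. l) x\<^sub>0 s t"
  have G: "?G \<in> PiM A (\<lambda>_. P) \<rightarrow>\<^sub>M N" if "{..<t} \<subseteq> A" for A
    by (rule measurable_model_iterates[where argmin_model = argmin_model and l = l]) (fact K \<open>x\<^sub>0 \<in> space N\<close> that)+
  have "(\<lambda>\<omega>. \<lambda>i\<in>UNIV. \<xi> i \<omega>) \<in> M \<rightarrow>\<^sub>M PiM UNIV (\<lambda>_. P)"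
    by (rule measurable_restrict) (rule rv)
  from measurable_compose[OF this G]
  moreover have x_eq: "x t = (\<lambda>\<omega>. model_iterates argmin_model (\<lambda>_. l) x\<^sub>0 (\<lambda>i. \<xi> i \<omega>) t)"
    by (simp add: x_def fun_eq_iff)
  ultimately show x_meas: "x t \<in> M \<rightarrow>\<^sub>M N" by (simp add: restrict_def)
  \<comment> \<open>Independence of two variables needs a common value type; so it is stated for two blocks of
    samples, and the joint law of \<open>(x t, \<xi> t)\<close> is an image of theirs.\<close>
  let ?A = "\<lambda>\<omega>. \<lambda>i\<in>{..<t}. \<xi> i \<omega>" and ?B = "\<lambda>\<omega>. \<lambda>i\<in>{t}. \<xi> i \<omega>"
  let ?PA = "PiM {..<t} (\<lambda>_. P)" and ?PB = "PiM {t} (\<lambda>_. P)"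
  let ?e = "\<lambda>s. s t"
  have ind: "M.indep_var ?PA ?A ?PB ?B"
    by (rule M.indep_var_restrict[OF indep]) auto
  have A: "?A \<in> M \<rightarrow>\<^sub>M ?PA" and B: "?B \<in> M \<rightarrow>\<^sub>M ?PB"
    by (rule measurable_restrict, rule rv)+
  have G': "?G \<in> ?PA \<rightarrow>\<^sub>M N" by (rule G) simp
  have e: "?e \<in> ?PB \<rightarrow>\<^sub>M P" by (rule measurable_component_singleton) simp
  have GA: "?G \<circ> ?A = x t"
    unfolding x_eq comp_def by (intro ext model_iterates_cong) simp
  have eB: "?e \<circ> ?B = \<xi> t" by auto
  have AB: "(\<lambda>\<omega>. (?A \<omega>, ?B \<omega>)) \<in> M \<rightarrow>\<^sub>M ?PA \<Otimes>\<^sub>M ?PB"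
    using A B by (rule measurable_Pair)
  have Ge: "(\<lambda>(a, b). (?G a, ?e b)) \<in> ?PA \<Otimes>\<^sub>M ?PB \<rightarrow>\<^sub>M N \<Otimes>\<^sub>M P"
    unfolding case_prod_beta
    by (intro measurable_Pair measurable_compose[OF measurable_fst G'] measurable_compose[OF measurable_snd e])
  have "(\<lambda>\<omega>. (x t \<omega>, \<xi> t \<omega>)) = (\<lambda>(a, b). (?G a, ?e b)) \<circ> (\<lambda>\<omega>. (?A \<omega>, ?B \<omega>))"
    unfolding GA[symmetric] eB[symmetric] by (simp add: comp_def)
  then have "distr M (N \<Otimes>\<^sub>M P) (\<lambda>\<omega>. (x t \<omega>, \<xi> t \<omega>))
      = distr (distr M (?PA \<Otimes>\<^sub>M ?PB) (\<lambda>\<omega>. (?A \<omega>, ?B \<omega>))) (N \<Otimes>\<^sub>M P) (\<lambda>(a, b). (?G a, ?e b))"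
    unfolding distr_distr[OF Ge AB] by (rule arg_cong)
  also have "distr M (?PA \<Otimes>\<^sub>M ?PB) (\<lambda>\<omega>. (?A \<omega>, ?B \<omega>)) = distr M ?PA ?A \<Otimes>\<^sub>M distr M ?PB ?B"
    using ind unfolding M.indep_var_distribution_eq by (elim conjE) (erule sym)
  also have "distr \<dots> (N \<Otimes>\<^sub>M P) (\<lambda>(a, b). (?G a, ?e b))
      = distr (distr M ?PA ?A) N ?G \<Otimes>\<^sub>M distr (distr M ?PB ?B) P ?e"
    using G' e distr_distr[OF e B] eB distr P.sigma_finite_measure_axioms
    by (intro pair_measure_distr[symmetric]) (simp_all cong: measurable_cong_sets)
  also have "distr (distr M ?PA ?A) N ?G = distr M N (x t)"
    using distr_distr[OF G' A] GA by simp
  also have "distr (distr M ?PB ?B) P ?e = P"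
    using distr_distr[OF e B] eB distr by simp
  finally have joint: "distr M (N \<Otimes>\<^sub>M P) (\<lambda>\<omega>. (x t \<omega>, \<xi> t \<omega>)) = distr M N (x t) \<Otimes>\<^sub>M P" .
  let ?k = "\<lambda>z. h (case z of (x, s) \<Rightarrow> argmin_model l x s)"
  have k: "?k \<in> borel_measurable (N \<Otimes>\<^sub>M P)" using measurable_compose[OF K h] .
  have k': "?k \<in> borel_measurable (distr M N (x t) \<Otimes>\<^sub>M P)"
    using k by (simp cong: measurable_cong_sets)
  have "(\<integral>\<^sup>+\<omega>. h (x (Suc t) \<omega>) \<partial>M) = (\<integral>\<^sup>+\<omega>. ?k (x t \<omega>, \<xi> t \<omega>) \<partial>M)"
    by (simp add: x_def)
  also have "\<dots> = (\<integral>\<^sup>+z. ?k z \<partial>(distr M N (x t) \<Otimes>\<^sub>M P))"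
    using x_meas rv k by (subst joint[symmetric], subst nn_integral_distr) auto
  also have "\<dots> = (\<integral>\<^sup>+z. (\<integral>\<^sup>+s. ?k (z, s) \<partial>P) \<partial>distr M N (x t))"
    using P.nn_integral_fst[OF k'] by simp
  also have "\<dots> = (\<integral>\<^sup>+\<omega>. (\<integral>\<^sup>+s. ?k (x t \<omega>, s) \<partial>P) \<partial>M)"
    using P.borel_measurable_nn_integral_fst[OF k]
    by (intro nn_integral_distr[OF x_meas]) simp
  finally show "(\<integral>\<^sup>+\<omega>. h (x (Suc t) \<omega>) \<partial>M) = (\<integral>\<^sup>+\<omega>. (\<integral>\<^sup>+s. h (argmin_model l (x t \<omega>) s) \<partial>P) \<partial>M)"
    by simp
qed

section \<open>Expected decrease in one step\<close>

lemma locally_lipschitz_measurable: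
  assumes "locally_lipschitz f"
  shows "f \<in> borel_measurable borel"
proof (rule borel_measurable_continuous_onI, rule continuous_at_imp_continuous_on, rule ballI)
  fix x
  obtain e C where "e > 0" and C: "C-lipschitz_on (ball x e) f"
    using assms unfolding locally_lipschitz_def by blast
  show "isCont f x"
    using continuous_on_interior[OF lipschitz_on_continuous_on[OF C]] \<open>e > 0\<close> by simp
qed

context stochastic_models
begin

abbreviation feasible :: "'a set" where
  "feasible \<equiv> int_dom \<Phi> \<inter> edom r"

lemma r_eq: "x \<in> edom r \<Longrightarrow> r x = ereal (finite_part r x)"
  by (rule finite_part_eq[OF r_not_MInf])

lemma r_finiteE:
  assumes "x \<in> edom r" obtains c where "r x = ereal c"
  using r_eq[OF assms] by blast

lemma int_domD: "x \<in> int_dom \<Phi> \<Longrightarrow> x \<in> edom \<Phi>"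
  using interior_subset by blast

lemma bregman_int_dom:
  "y \<in> int_dom \<Phi> \<Longrightarrow> x \<in> int_dom \<Phi> \<Longrightarrow> bregman \<Phi> y x = ereal (real_bregman \<Phi> y x)"
  by (intro bregman_eq_real_bregman legendre int_domD)

lemma convex_int_dom: "convex (int_dom \<Phi>)"
  using legendre_convex_on[OF legendre] convex_interior convex_on_imp_convex by blast

lemma convex_feasible: "convex feasible"
  by (intro convex_Int convex_int_dom convex_dom_r)

text \<open>Relative strong convexity yields plain convexity by adding back the convex function
  \<open>\<mu> \<Phi>\<close>. On the feasible set all values are finite, so this can be done in \<^typ>\<open>real\<close>.\<close>
lemma model_convex_on:
  assumes "x \<in> feasible"
  shows "AE s in P. convex_on feasible (\<lambda>y. model x y s + finite_part r y)"
  using model_convex[OF assms]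
proof eventually_elim
  case (elim s)
  let ?h = "\<lambda>y. model x y s + finite_part r y"
  have eq: "ereal (model x y s) + r y - ereal \<mu> * \<Phi> y = ereal (?h y - \<mu> * finite_part \<Phi> y)"
    if "y \<in> feasible" for y
  proof -
    obtain a where "r y = ereal a" using \<open>y \<in> feasible\<close> by (blast elim: r_finiteE)
    moreover obtain b where "\<Phi> y = ereal b"
      using legendre_finite[OF legendre int_domD, of y] \<open>y \<in> feasible\<close> by blast
    ultimately show ?thesis by simp
  qed
  show ?case
  proof (rule convex_onI)
    fix t :: real and a b assume t: "0 < t" "t < 1" and ab: "a \<in> feasible" "b \<in> feasible"
    let ?z = "(1 - t) *\<^sub>R a + t *\<^sub>R b"
    have z: "?z \<in> feasible" using convexD_alt[OF convex_feasible ab] t by simp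
    have "ereal (?h ?z - \<mu> * finite_part \<Phi> ?z)
        \<le> ereal (1 - t) * ereal (?h a - \<mu> * finite_part \<Phi> a) + ereal t * ereal (?h b - \<mu> * finite_part \<Phi> b)"
      using elim t ab unfolding rel_strongly_convex_on_def econvex_on_def
      by (subst (1 2 3) eq[symmetric]) (use ab z in auto)
    then have "?h ?z - \<mu> * finite_part \<Phi> ?z
        \<le> (1 - t) * (?h a - \<mu> * finite_part \<Phi> a) + t * (?h b - \<mu> * finite_part \<Phi> b)"
      by simp
    moreover have "\<mu> * finite_part \<Phi> ?z \<le> \<mu> * ((1 - t) * finite_part \<Phi> a + t * finite_part \<Phi> b)"
      using convex_onD[OF legendre_convex_on[OF legendre], of t a b] t ab int_domD \<mu>_nonneg
      by (intro mult_left_mono) auto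
    ultimately show "?h ?z \<le> (1 - t) * ?h a + t * ?h b"
      by (simp add: algebra_simps)
  qed (rule convex_feasible)
qed

text \<open>For a convex combination \<open>z\<close> of \<open>a\<close> and \<open>b\<close>, integrate the convexity inequality of the
  model centred at \<open>z\<close>: its left-hand side becomes \<open>F(z)\<close>, and its right-hand side can only
  grow when the means of the model at \<open>a\<close> and \<open>b\<close> are replaced by \<open>f a\<close> and \<open>f b\<close>.\<close>
lemma objective_convex_on: "convex_on feasible (\<lambda>y. f y + finite_part r y)"
proof (rule convex_onI)
  fix t :: real and a b assume t: "0 < t" "t < 1" and ab: "a \<in> feasible" "b \<in> feasible"
  let ?z = "(1 - t) *\<^sub>R a + t *\<^sub>R b"
  have z: "?z \<in> feasible" using convexD_alt[OF convex_feasible ab] t by simp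
  note int [simp] = model_unbiased[OF z, THEN conjunct1]
    model_underestimates[OF z ab(1), THEN conjunct1] model_underestimates[OF z ab(2), THEN conjunct1]
  have "(\<integral>s. model ?z ?z s + finite_part r ?z \<partial>P)
      \<le> (\<integral>s. (1 - t) * (model ?z a s + finite_part r a) + t * (model ?z b s + finite_part r b) \<partial>P)"
  proof (rule integral_mono_AE)
    show "AE s in P. model ?z ?z s + finite_part r ?z
        \<le> (1 - t) * (model ?z a s + finite_part r a) + t * (model ?z b s + finite_part r b)"
      using model_convex_on[OF z]
    proof eventually_elim
      case (elim s)
      from convex_onD[OF this, of t a b] show ?case using t ab by simp
    qed
  qed simp_all
  then have "f ?z + finite_part r ?z
      \<le> (1 - t) * ((\<integral>s. model ?z a s \<partial>P) + finite_part r a) + t * ((\<integral>s. model ?z b s \<partial>P) + finite_part r b)"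
    using model_unbiased[OF z] by (simp add: prob_space)
  also have "\<dots> \<le> (1 - t) * (f a + finite_part r a) + t * (f b + finite_part r b)"
    using model_underestimates[OF z ab(1)] model_underestimates[OF z ab(2)] t
    by (intro add_mono mult_left_mono) auto
  finally show "f ?z + finite_part r ?z \<le> (1 - t) * (f a + finite_part r a) + t * (f b + finite_part r b)" .
qed (rule convex_feasible)

text \<open>In the three-point inequality, moving the model's value from the next iterate \<open>p\<close> back to \<open>x\<close>
  costs \<open>l L(s) sqrt d\<close> with \<open>d = D(p, x)\<close>, and \<open>d\<close> itself is available to pay for it: the minimum of
  \<open>d - l L(s) sqrt d\<close> over \<open>sqrt d\<close> is \<open>-l\<^sup>2 L(s)\<^sup>2 / 4\<close>.\<close>
lemma model_step:
  assumes l: "0 < l" and x: "x \<in> feasible" and y: "y \<in> feasible"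
  shows "AE s in P. argmin_model l x s \<in> feasible \<and>
    l * (model x x s + finite_part r (argmin_model l x s)) + real_bregman \<Phi> y (argmin_model l x s)
      \<le> l * (model x y s + finite_part r y) + real_bregman \<Phi> y x + l\<^sup>2 * (lip s)\<^sup>2 / 4"
proof -
  have "x \<in> int_dom \<Phi>" using x by simp
  from model_convex_on[OF x] argmin_model[OF l this] model_lipschitz[OF x]
  show ?thesis
  proof eventually_elim
    case (elim s)
    let ?G = "\<lambda>y. ereal (model x y s) + r y + ereal (1 / l) * bregman \<Phi> y x"
    define p where "p = argmin_model l x s"
    have argmin: "is_arg_min ?G (\<lambda>z. z \<in> int_dom \<Phi>) p"
      using elim(2) by (simp add: unique_argmin_on_def p_def)
    then have le: "?G p \<le> ?G z" if "z \<in> int_dom \<Phi>" for z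
      using that unfolding is_arg_min_def by (auto simp: not_less)
    have p_int: "p \<in> int_dom \<Phi>" using argmin by (simp add: is_arg_min_def)
    have G: "?G z = ereal (model x z s + finite_part r z + real_bregman \<Phi> z x / l)" if "z \<in> feasible" for z
    proof -
      obtain c where "r z = ereal c" using \<open>z \<in> feasible\<close> by (blast elim: r_finiteE)
      then show ?thesis using that x by (simp add: bregman_int_dom)
    qed
    have "r p \<noteq> \<infinity>"
    proof
      assume "r p = \<infinity>"
      then have "?G p = \<infinity>" using bregman_int_dom[OF p_int, of x] x by simp
      moreover have "?G p \<le> ?G x" by (rule le) (use x in simp)
      ultimately show False using G[OF x] by (metis ereal_infty_less_eq(1) PInfty_neq_ereal(1))
    qed
    then have p: "p \<in> feasible" using p_int by (simp add: edom_def)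
    have "l * (model x p s + finite_part r p) + real_bregman \<Phi> p x + real_bregman \<Phi> y p
        \<le> l * (model x y s + finite_part r y) + real_bregman \<Phi> y x"
    proof (rule three_point_inequality[OF legendre _ elim(1) l _ p y])
      fix z assume z: "z \<in> feasible"
      then show "model x p s + finite_part r p + real_bregman \<Phi> p x / l
          \<le> model x z s + finite_part r z + real_bregman \<Phi> z x / l"
        using le[of z] G[OF z] G[OF p] by simp
    qed (use x in auto)
    moreover
    have "model x x s - model x p s \<le> lip s * sqrt (real_bregman \<Phi> p x)"
      using bspec[OF elim(3) p] bregman_int_dom[OF p_int, of x] x by simp
    then have "l * (model x x s - model x p s) \<le> l * (lip s * sqrt (real_bregman \<Phi> p x))"
      using l by simp
    moreover
    have "0 \<le> (sqrt (real_bregman \<Phi> p x) - l * lip s / 2)\<^sup>2" by simp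
    then have "l * (lip s * sqrt (real_bregman \<Phi> p x)) \<le> real_bregman \<Phi> p x + l\<^sup>2 * (lip s)\<^sup>2 / 4"
      using real_bregman_nonneg[OF legendre, of p x] p x int_domD
      by (simp add: power2_diff power_mult_distrib power_divide algebra_simps)
    ultimately show ?case
      using p unfolding p_def[symmetric] by (simp add: algebra_simps)
  qed
qed

text \<open>The parameter \<open>F\<^sub>0\<close> stands for the minimal value of the objective; for larger \<open>F\<^sub>0\<close>, negative
  differences would be truncated to \<open>0\<close>.\<close>
definition gap :: "real \<Rightarrow> 'a \<Rightarrow> ennreal" where
  "gap F\<^sub>0 x = e2ennreal (objective f r x - ereal F\<^sub>0)"

text \<open>The telescoping quantity; \<open>\<rho>\<close> stands for a lower bound of \<open>r\<close>.\<close>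
definition lyapunov :: "real \<Rightarrow> real \<Rightarrow> 'a \<Rightarrow> 'a \<Rightarrow> ennreal" where
  "lyapunov l \<rho> y x = ennreal (real_bregman \<Phi> y x) + ennreal l * e2ennreal (r x - ereal \<rho>)"

lemma r_measurable: "r \<in> borel_measurable borel"
  by (rule closed_fun_measurable[OF r_closed])

lemma gap_measurable: "gap F\<^sub>0 \<in> borel_measurable borel"
  using r_measurable locally_lipschitz_measurable[OF f_locally_lipschitz]
  unfolding gap_def objective_def by measurable

lemma lyapunov_measurable:
  "lyapunov l \<rho> y \<in> borel_measurable (restrict_space borel (int_dom \<Phi>))"
proof -
  have [measurable]: "r \<in> borel_measurable (restrict_space borel (int_dom \<Phi>))"
    by (rule measurable_restrict_space1[OF r_measurable])
  note [measurable] = real_bregman_measurable[OF legendre]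
  show ?thesis unfolding lyapunov_def by measurable
qed

lemma gap_feasible:
  assumes "x \<in> edom r"
  shows "gap F\<^sub>0 x = ennreal (f x + finite_part r x - F\<^sub>0)"
proof -
  obtain c where "r x = ereal c" using assms by (blast elim: r_finiteE)
  then show ?thesis by (simp add: gap_def objective_def)
qed

lemma gap_infeasible: "x \<notin> edom r \<Longrightarrow> gap F\<^sub>0 x = \<top>"
  by (simp add: gap_def objective_def edom_def)

lemma lyapunov_feasible:
  assumes "x \<in> feasible" "y \<in> feasible" "0 < l" "\<And>z. ereal \<rho> \<le> r z"
  shows "lyapunov l \<rho> y x = ennreal (real_bregman \<Phi> y x + l * (finite_part r x - \<rho>))"
proof -
  obtain c where c: "r x = ereal c" using assms by (blast elim: r_finiteE)
  moreover have "\<rho> \<le> c" using c assms(4)[of x] by simp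
  moreover have "0 \<le> real_bregman \<Phi> y x"
    using assms int_domD by (intro real_bregman_nonneg legendre) auto
  ultimately show ?thesis
    using assms(3) by (simp add: lyapunov_def ennreal_mult)
qed

lemma lyapunov_infeasible: "x \<notin> edom r \<Longrightarrow> 0 < l \<Longrightarrow> lyapunov l \<rho> y x = \<top>"
  by (simp add: lyapunov_def edom_def ennreal_mult_top)

text \<open>If \<open>r x = \<infinity>\<close>, the right-hand side is infinite. Otherwise \<open>model_step\<close> bounds the Lyapunov
  function at the next iterate by an integrable function of the sample, whose mean is controlled by
  unbiasedness, underestimation and the second moment of \<open>lip\<close>. This mean contains
  \<open>-l f x\<close>, which the gap at \<open>x\<close> turns into \<open>l r x\<close>, the summand that
  the Lyapunov function at \<open>x\<close> provides.\<close>
lemma lyapunov_descent: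
  assumes l: "0 < l" and x: "x \<in> int_dom \<Phi>" and y: "y \<in> feasible"
    and \<rho>: "\<And>z. ereal \<rho> \<le> r z" and F\<^sub>0: "\<And>z. ereal F\<^sub>0 \<le> objective f r z"
  shows "(\<integral>\<^sup>+s. lyapunov l \<rho> y (argmin_model l x s) \<partial>P) + ennreal l * gap F\<^sub>0 x
    \<le> lyapunov l \<rho> y x + ennreal (l\<^sup>2 * \<L>\<^sup>2 / 4 + l * (f y + finite_part r y - F\<^sub>0))"
proof (cases "x \<in> edom r")
  case False
  then show ?thesis using lyapunov_infeasible[OF False l] by simp
next
  case True
  then have x: "x \<in> feasible" using x by simp
  let ?v = "\<lambda>z. real_bregman \<Phi> y z + l * (finite_part r z - \<rho>)"
  let ?g = "\<lambda>s. real_bregman \<Phi> y x + l\<^sup>2 * (lip s)\<^sup>2 / 4 + l * (model x y s - model x x s)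
      + l * (finite_part r y - \<rho>)"
  have r_ge: "\<rho> \<le> finite_part r z" if "z \<in> edom r" for z
  proof -
    obtain c where "r z = ereal c" using \<open>z \<in> edom r\<close> by (blast elim: r_finiteE)
    then show ?thesis using \<rho>[of z] by simp
  qed
  have F_ge: "F\<^sub>0 \<le> f z + finite_part r z" if "z \<in> edom r" for z
  proof -
    obtain c where "r z = ereal c" using \<open>z \<in> edom r\<close> by (blast elim: r_finiteE)
    then show ?thesis using F\<^sub>0[of z] by (simp add: objective_def)
  qed
  have v_nonneg: "0 \<le> ?v z" if "z \<in> feasible" for z
    using real_bregman_nonneg[OF legendre, of y z] r_ge[of z] that y int_domD l by auto
  have step: "AE s in P. lyapunov l \<rho> y (argmin_model l x s) \<le> ennreal (?g s) \<and> 0 \<le> ?g s"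
    using model_step[OF l x y]
  proof eventually_elim
    case (elim s)
    let ?p = "argmin_model l x s"
    have p: "?p \<in> feasible" and "?v ?p \<le> ?g s" using elim by (auto simp: algebra_simps)
    then show ?case
      using v_nonneg[OF p] lyapunov_feasible[OF p y l \<rho>] by (auto intro: ennreal_leI)
  qed
  note [simp] = lip_square_integrable model_unbiased[OF x, THEN conjunct1] model_underestimates[OF x y, THEN conjunct1]
  have "(\<integral>\<^sup>+s. lyapunov l \<rho> y (argmin_model l x s) \<partial>P) \<le> (\<integral>\<^sup>+s. ennreal (?g s) \<partial>P)"
    using step by (intro nn_integral_mono_AE) auto
  also have "\<dots> = ennreal (\<integral>s. ?g s \<partial>P)"
    using step by (intro nn_integral_eq_integral) auto
  finally have V: "(\<integral>\<^sup>+s. lyapunov l \<rho> y (argmin_model l x s) \<partial>P) \<le> ennreal (\<integral>s. ?g s \<partial>P)" .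
  have g_nonneg: "0 \<le> (\<integral>s. ?g s \<partial>P)"
    using step by (intro integral_nonneg_AE) auto
  have "(\<integral>s. ?g s \<partial>P) = real_bregman \<Phi> y x + l\<^sup>2 * (\<integral>s. (lip s)\<^sup>2 \<partial>P) / 4
      + l * ((\<integral>s. model x y s \<partial>P) - f x) + l * (finite_part r y - \<rho>)"
    using model_unbiased[OF x] by (simp add: prob_space)
  also have "\<dots> \<le> real_bregman \<Phi> y x + l\<^sup>2 * \<L>\<^sup>2 / 4 + l * (f y - f x) + l * (finite_part r y - \<rho>)"
    using model_underestimates[OF x y] l sqrt_le_D[OF lip_bound]
    by (intro add_mono mult_left_mono divide_right_mono) auto
  finally have g_le: "(\<integral>s. ?g s \<partial>P)
      \<le> real_bregman \<Phi> y x + l\<^sup>2 * \<L>\<^sup>2 / 4 + l * (f y - f x) + l * (finite_part r y - \<rho>)" .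
  have "(\<integral>\<^sup>+s. lyapunov l \<rho> y (argmin_model l x s) \<partial>P) + ennreal l * gap F\<^sub>0 x
      \<le> ennreal (\<integral>s. ?g s \<partial>P) + ennreal (l * (f x + finite_part r x - F\<^sub>0))"
    using V l F_ge[of x] x by (simp add: gap_feasible ennreal_mult add_right_mono)
  also have "\<dots> = ennreal ((\<integral>s. ?g s \<partial>P) + l * (f x + finite_part r x - F\<^sub>0))"
    using g_nonneg l F_ge[of x] x by (subst ennreal_plus) auto
  also have "\<dots> \<le> ennreal (?v x + (l\<^sup>2 * \<L>\<^sup>2 / 4 + l * (f y + finite_part r y - F\<^sub>0)))"
    using g_le by (intro ennreal_leI) (simp add: algebra_simps)
  also have "\<dots> = lyapunov l \<rho> y x + ennreal (l\<^sup>2 * \<L>\<^sup>2 / 4 + l * (f y + finite_part r y - F\<^sub>0))"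
    using v_nonneg[OF x] l F_ge[of y] y lyapunov_feasible[OF x y l \<rho>]
    by (subst ennreal_plus) auto
  finally show ?thesis .
qed

section \<open>Summation over the steps and averaging\<close>

lemma gap_sum_le_lyapunov:
  assumes M: "prob_space M" and indep: "prob_space.indep_vars M (\<lambda>_. P) \<xi> UNIV"
    and distr: "\<And>t. distr M P (\<xi> t) = P"
    and x\<^sub>0: "x\<^sub>0 \<in> int_dom \<Phi>" and l: "0 < l"
    and x_def: "\<And>t \<omega>. x t \<omega> = model_iterates argmin_model (\<lambda>_. l) x\<^sub>0 (\<lambda>i. \<xi> i \<omega>) t"
    and y: "y \<in> feasible"
    and \<rho>: "\<And>z. ereal \<rho> \<le> r z" and F\<^sub>0: "\<And>z. ereal F\<^sub>0 \<le> objective f r z"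
  shows "(\<integral>\<^sup>+\<omega>. lyapunov l \<rho> y (x n \<omega>) \<partial>M) + ennreal l * (\<Sum>t<n. \<integral>\<^sup>+\<omega>. gap F\<^sub>0 (x t \<omega>) \<partial>M)
    \<le> lyapunov l \<rho> y x\<^sub>0 + of_nat n * ennreal (l\<^sup>2 * \<L>\<^sup>2 / 4 + l * (f y + finite_part r y - F\<^sub>0))"
    (is "?V n + _ * (\<Sum>t<n. ?g t) \<le> _ + _ * ?k")
proof (induction n)
  case 0
  interpret M: prob_space M by (rule M)
  show ?case by (simp add: x_def M.emeasure_space_1)
next
  case (Suc n)
  interpret M: prob_space M by (rule M)
  let ?N = "restrict_space borel (int_dom \<Phi>)"
  have space: "x\<^sub>0 \<in> space ?N" using x\<^sub>0 by (simp add: space_restrict_space)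
  note iterates = nn_integral_model_iterates_Suc[where argmin_model = argmin_model and l = l,
      OF M indep distr argmin_model_measurable[OF l] space lyapunov_measurable x_def]
  have x_meas: "x n \<in> M \<rightarrow>\<^sub>M ?N" by (rule iterates(2))
  have x_int: "x n \<omega> \<in> int_dom \<Phi>" if "\<omega> \<in> space M" for \<omega>
    using measurable_space[OF x_meas that] by (simp add: space_restrict_space)
  have [measurable]: "(\<lambda>\<omega>. gap F\<^sub>0 (x n \<omega>)) \<in> borel_measurable M"
    "(\<lambda>\<omega>. lyapunov l \<rho> y (x n \<omega>)) \<in> borel_measurable M"
    using measurable_compose[OF x_meas measurable_restrict_space1[OF gap_measurable]]
      measurable_compose[OF x_meas lyapunov_measurable] by auto
  have "(\<lambda>z. lyapunov l \<rho> y (case z of (x, s) \<Rightarrow> argmin_model l x s)) \<in> borel_measurable (?N \<Otimes>\<^sub>M P)"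
    using measurable_compose[OF argmin_model_measurable[OF l] lyapunov_measurable] .
  from measurable_compose[OF x_meas borel_measurable_nn_integral_fst[OF this]]
  have [measurable]: "(\<lambda>\<omega>. \<integral>\<^sup>+s. lyapunov l \<rho> y (argmin_model l (x n \<omega>) s) \<partial>P) \<in> borel_measurable M"
    by simp
  have "?V (Suc n) + ennreal l * ?g n
      = (\<integral>\<^sup>+\<omega>. (\<integral>\<^sup>+s. lyapunov l \<rho> y (argmin_model l (x n \<omega>) s) \<partial>P) + ennreal l * gap F\<^sub>0 (x n \<omega>) \<partial>M)"
    unfolding iterates(1) by (subst nn_integral_add) (simp_all add: nn_integral_cmult)
  also have "\<dots> \<le> (\<integral>\<^sup>+\<omega>. lyapunov l \<rho> y (x n \<omega>) + ?k \<partial>M)"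
    using lyapunov_descent[OF l x_int y \<rho> F\<^sub>0] by (intro nn_integral_mono)
  also have "\<dots> = ?V n + ?k"
    by (simp add: nn_integral_add M.emeasure_space_1)
  finally have "?V (Suc n) + ennreal l * ?g n + ennreal l * (\<Sum>t<n. ?g t)
      \<le> ?V n + ?k + ennreal l * (\<Sum>t<n. ?g t)"
    by (rule add_right_mono)
  also have "\<dots> \<le> ?k + (lyapunov l \<rho> y x\<^sub>0 + of_nat n * ?k)"
    using add_left_mono[OF Suc, of ?k] by (simp add: ac_simps)
  finally show ?case by (simp add: algebra_simps)
qed

text \<open>The proximal point \<open>y\<close> satisfies
  \<open>F(y) + D(y, x\<^sub>0) / l \<le> F(z) + D(z, x\<^sub>0) / l\<close>. Together with \<open>F(z) \<le> F(y)\<close> this bounds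
  \<open>D(y, x\<^sub>0)\<close> by \<open>D(z, x\<^sub>0)\<close>; together with \<open>D(y, x\<^sub>0) \<ge> 0\<close> it bounds \<open>F(y) - F(z)\<close> by
  \<open>D(z, x\<^sub>0) / l\<close>. On a segment from \<open>x\<^sub>0\<close> to \<open>z\<close>, by contrast, convergence of
  the values of \<open>F\<close> to \<open>F(z)\<close> would require continuity of \<open>r\<close> at \<open>z\<close> along the segment.\<close>
lemma feasible_approximate_minimizer:
  assumes x\<^sub>0: "x\<^sub>0 \<in> int_dom \<Phi>" and z: "z \<in> edom \<Phi>" "z \<in> edom r"
    and min: "\<And>y. objective f r z \<le> objective f r y" and \<delta>: "0 < \<delta>"
  obtains y where "y \<in> feasible" "real_bregman \<Phi> y x\<^sub>0 \<le> real_bregman \<Phi> z x\<^sub>0"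
    "f y + finite_part r y \<le> f z + finite_part r z + \<delta>"
proof -
  let ?D = "real_bregman \<Phi> z x\<^sub>0"
  \<comment> \<open>Chosen to make \<open>?D / l \<le> \<delta>\<close>.\<close>
  define l where "l = (\<bar>?D\<bar> + 1) / \<delta>"
  have l: "0 < l" using \<delta> by (simp add: l_def divide_pos_pos add_nonneg_pos)
  let ?G = "\<lambda>y. objective f r y + ereal (1 / l) * bregman \<Phi> y x\<^sub>0"
  obtain p where p: "p \<in> restrict_space borel (int_dom \<Phi>) \<rightarrow>\<^sub>M restrict_space borel (int_dom \<Phi>)"
    and argmin: "unique_argmin_on UNIV ?G (p x\<^sub>0)"
    using prox_objective[OF l] x\<^sub>0 by blast
  define y where "y = p x\<^sub>0"
  have y_int: "y \<in> int_dom \<Phi>"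
    using measurable_space[OF p] x\<^sub>0 by (simp add: space_restrict_space y_def)
  have le: "?G y \<le> ?G z"
    using argmin by (auto simp: unique_argmin_on_def is_arg_min_def y_def not_less)
  obtain c where c: "r z = ereal c" using z(2) by (blast elim: r_finiteE)
  have Gz: "?G z = ereal (f z + c + ?D / l)"
    using c bregman_eq_real_bregman[OF legendre z(1) int_domD[OF x\<^sub>0]] by (simp add: objective_def)
  have "r y \<noteq> \<infinity>"
    using le Gz bregman_int_dom[OF y_int x\<^sub>0] by (auto simp: objective_def)
  then have y_r: "y \<in> edom r" by (simp add: edom_def)
  then obtain d where d: "r y = ereal d" by (blast elim: r_finiteE)
  have *: "f y + d + real_bregman \<Phi> y x\<^sub>0 / l \<le> f z + c + ?D / l"
    using le Gz bregman_int_dom[OF y_int x\<^sub>0] d by (simp add: objective_def)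
  have **: "f z + c \<le> f y + d" using min[of y] c d by (simp add: objective_def)
  have "real_bregman \<Phi> y x\<^sub>0 / l \<le> ?D / l" using * ** by simp
  then have D: "real_bregman \<Phi> y x\<^sub>0 \<le> ?D" using l by (simp add: divide_le_cancel)
  have "0 \<le> real_bregman \<Phi> y x\<^sub>0 / l"
    using real_bregman_nonneg[OF legendre int_domD[OF y_int] x\<^sub>0] l by simp
  moreover have "?D / l \<le> \<delta>"
  proof -
    have "?D \<le> \<delta> * l" using \<delta> by (simp add: l_def)
    then show ?thesis using l by (simp add: pos_divide_le_eq)
  qed
  ultimately have "f y + d \<le> f z + c + \<delta>" using * by simp
  then show ?thesis using that[of y] y_int y_r D c d by simp
qed

lemma gap_average_le:
  assumes "finite I" "I \<noteq> {}" "\<And>i. i \<in> I \<Longrightarrow> z i \<in> int_dom \<Phi>"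
    and F\<^sub>0: "\<And>y. ereal F\<^sub>0 \<le> objective f r y"
  shows "gap F\<^sub>0 ((1 / card I) *\<^sub>R (\<Sum>i\<in>I. z i)) \<le> ennreal (1 / card I) * (\<Sum>i\<in>I. gap F\<^sub>0 (z i))"
proof (cases "\<forall>i\<in>I. z i \<in> edom r")
  case False
  then obtain i where i: "i \<in> I" "gap F\<^sub>0 (z i) = \<top>" using gap_infeasible by blast
  then have "(\<Sum>i\<in>I. gap F\<^sub>0 (z i)) = \<top>" using assms(1) by (simp add: sum.remove)
  moreover have "0 < 1 / real (card I)" using assms(1,2) by (simp add: card_gt_0_iff)
  ultimately show ?thesis by (simp add: ennreal_mult_top)
next
  case True
  let ?F = "\<lambda>y. f y + finite_part r y"
  let ?w = "1 / real (card I)"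
  have w: "0 \<le> ?w" "(\<Sum>i\<in>I. ?w) = 1" using assms(1,2) by auto
  have z: "z i \<in> feasible" if "i \<in> I" for i using True assms(3) that by auto
  have avg: "?w *\<^sub>R (\<Sum>i\<in>I. z i) = (\<Sum>i\<in>I. ?w *\<^sub>R z i)" by (simp add: scaleR_sum_right)
  have feas: "?w *\<^sub>R (\<Sum>i\<in>I. z i) \<in> feasible"
    unfolding avg by (rule convex_sum[OF assms(1) convex_feasible w(2,1) z])
  have F_ge: "F\<^sub>0 \<le> ?F y" if y: "y \<in> edom r" for y
  proof -
    obtain c where "r y = ereal c" using y by (blast elim: r_finiteE)
    then show ?thesis using F\<^sub>0[of y] by (simp add: objective_def)
  qed
  have "?F (?w *\<^sub>R (\<Sum>i\<in>I. z i)) \<le> (\<Sum>i\<in>I. ?w * ?F (z i))"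
    unfolding avg by (rule convex_on_sum[OF assms(1,2) objective_convex_on w(2,1) z])
  moreover have "?w * (\<Sum>i\<in>I. ?F (z i) - F\<^sub>0) = (\<Sum>i\<in>I. ?w * ?F (z i)) - F\<^sub>0"
    unfolding sum_subtractf sum_distrib_left[symmetric] using assms(1,2) by (simp add: field_simps)
  ultimately have "?F (?w *\<^sub>R (\<Sum>i\<in>I. z i)) - F\<^sub>0 \<le> ?w * (\<Sum>i\<in>I. ?F (z i) - F\<^sub>0)"
    by linarith
  then have "ennreal (?F (?w *\<^sub>R (\<Sum>i\<in>I. z i)) - F\<^sub>0) \<le> ennreal ?w * (\<Sum>i\<in>I. ennreal (?F (z i) - F\<^sub>0))"
    using w F_ge z by (simp add: sum_ennreal sum_nonneg ennreal_leI flip: ennreal_mult')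
  also have "(\<Sum>i\<in>I. ennreal (?F (z i) - F\<^sub>0)) = (\<Sum>i\<in>I. gap F\<^sub>0 (z i))"
    using z by (intro sum.cong) (auto simp: gap_feasible)
  finally show ?thesis using feas by (simp add: gap_feasible)
qed

text \<open>The comparison points of \<open>feasible_approximate_minimizer\<close> cost \<open>\<delta>\<close> per step; the claim follows
  as \<open>\<delta>\<close> tends to \<open>0\<close>.\<close>
lemma expected_gap_average_le:
  assumes M: "prob_space M" and indep: "prob_space.indep_vars M (\<lambda>_. P) \<xi> UNIV"
    and distr: "\<And>t. distr M P (\<xi> t) = P"
    and x\<^sub>0: "x\<^sub>0 \<in> feasible" and l: "0 < l"
    and x_def: "\<And>t \<omega>. x t \<omega> = model_iterates argmin_model (\<lambda>_. l) x\<^sub>0 (\<lambda>i. \<xi> i \<omega>) t"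
    and z: "z \<in> edom \<Phi>" "z \<in> edom r" and min: "\<And>y. objective f r z \<le> objective f r y"
    and \<rho>: "\<And>z. ereal \<rho> \<le> r z"
  shows "(\<integral>\<^sup>+\<omega>. gap (f z + finite_part r z) ((1 / (real T + 1)) *\<^sub>R (\<Sum>t=0..T. x t \<omega>)) \<partial>M)
    \<le> ennreal ((real_bregman \<Phi> z x\<^sub>0 + (real T + 1) * (l * \<L>)\<^sup>2 / 4 + l * (finite_part r x\<^sub>0 - \<rho>))
        / (l * (real T + 1)))"
proof (rule ennreal_le_epsilon)
  interpret M: prob_space M by (rule M)
  let ?N = "restrict_space borel (int_dom \<Phi>)"
  let ?n = "real T + 1" and ?F\<^sub>0 = "f z + finite_part r z"
  let ?g = "\<lambda>t. \<integral>\<^sup>+\<omega>. gap ?F\<^sub>0 (x t \<omega>) \<partial>M"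
  fix \<delta> :: real assume \<delta>: "0 < \<delta>"
  have x\<^sub>0_int: "x\<^sub>0 \<in> int_dom \<Phi>" and n: "0 < ?n" using x\<^sub>0 by auto
  obtain c where "r z = ereal c" using z(2) by (blast elim: r_finiteE)
  then have F\<^sub>0: "ereal ?F\<^sub>0 \<le> objective f r y" for y
    using min[of y] by (simp add: objective_def)
  obtain y where y: "y \<in> feasible" and D: "real_bregman \<Phi> y x\<^sub>0 \<le> real_bregman \<Phi> z x\<^sub>0"
    and Fy: "f y + finite_part r y \<le> ?F\<^sub>0 + \<delta>"
    using feasible_approximate_minimizer[OF x\<^sub>0_int z min \<delta>] by blast
  obtain c\<^sub>0 where "r x\<^sub>0 = ereal c\<^sub>0" using x\<^sub>0 by (blast elim: r_finiteE)
  then have \<rho>_le: "\<rho> \<le> finite_part r x\<^sub>0" using \<rho>[of x\<^sub>0] by simp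
  have D_nonneg: "0 \<le> real_bregman \<Phi> y x\<^sub>0"
    using y x\<^sub>0 int_domD by (intro real_bregman_nonneg legendre) auto
  have space: "x\<^sub>0 \<in> space ?N" using x\<^sub>0 by (simp add: space_restrict_space)
  have x_meas: "x t \<in> M \<rightarrow>\<^sub>M ?N" for t
    by (rule nn_integral_model_iterates_Suc(2)[where argmin_model = argmin_model and l = l,
      OF M indep distr argmin_model_measurable[OF l] space lyapunov_measurable x_def])
  have x_int: "x t \<omega> \<in> int_dom \<Phi>" if "\<omega> \<in> space M" for t \<omega>
    using measurable_space[OF x_meas that] by (simp add: space_restrict_space)
  have [measurable]: "(\<lambda>\<omega>. gap ?F\<^sub>0 (x t \<omega>)) \<in> borel_measurable M" for t
    using measurable_compose[OF x_meas measurable_restrict_space1[OF gap_measurable]] .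
  let ?B = "real_bregman \<Phi> z x\<^sub>0 + ?n * (l * \<L>)\<^sup>2 / 4 + l * (finite_part r x\<^sub>0 - \<rho>)"
  have factor: "B + m * d = m * (B / m + d)" if "m \<noteq> 0" for B m d :: real
    using that by (simp add: distrib_left)
  have B: "0 \<le> ?B" using D D_nonneg \<rho>_le l by simp
  have "ennreal l * (\<Sum>t<Suc T. ?g t)
      \<le> lyapunov l \<rho> y x\<^sub>0 + of_nat (Suc T) * ennreal (l\<^sup>2 * \<L>\<^sup>2 / 4 + l * (f y + finite_part r y - ?F\<^sub>0))"
    using gap_sum_le_lyapunov[OF M indep distr x\<^sub>0_int l x_def y \<rho> F\<^sub>0, of "Suc T"]
    by (rule order_trans[rotated]) simp
  also have "\<dots> \<le> ennreal (real_bregman \<Phi> z x\<^sub>0 + l * (finite_part r x\<^sub>0 - \<rho>))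
      + ennreal ?n * ennreal (l\<^sup>2 * \<L>\<^sup>2 / 4 + l * \<delta>)"
    unfolding lyapunov_feasible[OF x\<^sub>0 y l \<rho>] ennreal_of_nat_eq_real_of_nat
    using D Fy l by (intro add_mono mult_mono ennreal_leI mult_left_mono) auto
  also have "\<dots> = ennreal (real_bregman \<Phi> z x\<^sub>0 + l * (finite_part r x\<^sub>0 - \<rho>)
      + ?n * (l\<^sup>2 * \<L>\<^sup>2 / 4 + l * \<delta>))"
    using D D_nonneg \<rho>_le l n \<delta>
    by (subst ennreal_mult[symmetric], simp_all del: ennreal_plus add: ennreal_plus[symmetric])
  also have "real_bregman \<Phi> z x\<^sub>0 + l * (finite_part r x\<^sub>0 - \<rho>) + ?n * (l\<^sup>2 * \<L>\<^sup>2 / 4 + l * \<delta>)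
      = ?B + l * ?n * \<delta>"
    by (simp add: power_mult_distrib algebra_simps)
  also have "\<dots> = l * ?n * (?B / (l * ?n) + \<delta>)"
    by (rule factor) (use l n in simp)
  finally have le: "ennreal l * (\<Sum>t<Suc T. ?g t) \<le> ennreal (l * ?n * (?B / (l * ?n) + \<delta>))" .
  have "(\<integral>\<^sup>+\<omega>. gap ?F\<^sub>0 ((1 / ?n) *\<^sub>R (\<Sum>t=0..T. x t \<omega>)) \<partial>M)
      \<le> (\<integral>\<^sup>+\<omega>. ennreal (1 / ?n) * (\<Sum>t<Suc T. gap ?F\<^sub>0 (x t \<omega>)) \<partial>M)"
  proof (rule nn_integral_mono)
    fix \<omega> assume "\<omega> \<in> space M"
    with gap_average_le[of "{..<Suc T}" "\<lambda>t. x t \<omega>", OF _ _ x_int F\<^sub>0]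
    show "gap ?F\<^sub>0 ((1 / ?n) *\<^sub>R (\<Sum>t=0..T. x t \<omega>)) \<le> ennreal (1 / ?n) * (\<Sum>t<Suc T. gap ?F\<^sub>0 (x t \<omega>))"
      by (simp add: atLeast0AtMost lessThan_Suc_atMost ac_simps)
  qed
  also have "\<dots> = ennreal (1 / ?n) * (\<Sum>t<Suc T. ?g t)"
    by (simp add: nn_integral_cmult nn_integral_sum del: sum.lessThan_Suc)
  also have "\<dots> = ennreal (1 / (l * ?n)) * (ennreal l * (\<Sum>t<Suc T. ?g t))"
    using l n by (simp add: mult.assoc[symmetric] del: sum.lessThan_Suc flip: ennreal_mult)
  also have "\<dots> \<le> ennreal (1 / (l * ?n)) * ennreal (l * ?n * (?B / (l * ?n) + \<delta>))"
    by (rule mult_left_mono[OF le]) simp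
  also have "\<dots> = ennreal (?B / (l * ?n) + \<delta>)"
    using l n B \<delta> by (simp flip: ennreal_mult)
  also have "\<dots> = ennreal (?B / (l * ?n)) + ennreal \<delta>"
    using l n B \<delta> by (intro ennreal_plus) auto
  finally show "(\<integral>\<^sup>+\<omega>. gap ?F\<^sub>0 ((1 / ?n) *\<^sub>R (\<Sum>t=0..T. x t \<omega>)) \<partial>M)
      \<le> ennreal (?B / (l * ?n)) + ennreal \<delta>" .
qed

end

theorem corollary7p3:
  fixes \<Phi> :: "'a::euclidean_space \<Rightarrow> ereal"
    and f :: "'a \<Rightarrow> real"
    and r :: "'a \<Rightarrow> ereal"
    and P :: "'b measure"
    and model :: "'a \<Rightarrow> 'a \<Rightarrow> 'b \<Rightarrow> real"
    and \<mu> \<L> \<alpha> :: real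
    and lip :: "'b \<Rightarrow> real"
    and argmin_model :: "real \<Rightarrow> 'a \<Rightarrow> 'b \<Rightarrow> 'a"
    and M :: "'w measure"
    and \<xi> :: "nat \<Rightarrow> 'w \<Rightarrow> 'b"
    and x\<^sub>0 x_star :: 'a
    and T :: nat
    and x :: "nat \<Rightarrow> 'w \<Rightarrow> 'a"
  assumes "stochastic_models \<Phi> f r P model \<mu> lip \<L> argmin_model"
    and "prob_space M"
    and "prob_space.indep_vars M (\<lambda>_. P) \<xi> UNIV"
    and "\<And>t. distr M P (\<xi> t) = P"
    and "x\<^sub>0 \<in> int_dom \<Phi> \<inter> edom r"
    and "\<alpha> > 0"
    and "T > 0"
    and "\<And>t \<omega>. x t \<omega> =
           model_iterates argmin_model (\<lambda>_. \<alpha> / sqrt (real T + 1)) x\<^sub>0 (\<lambda>i. \<xi> i \<omega>) t"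
    and "is_arg_min (objective f r) (\<lambda>_. True) x_star"
  shows "expectation_nonneg M
           (\<lambda>\<omega>. objective f r ((1 / (real T + 1)) *\<^sub>R (\<Sum>t=0..T. x t \<omega>)) - objective f r x_star)
         \<le> (bregman \<Phi> x_star x\<^sub>0 + ereal ((\<alpha> * \<L>)\<^sup>2 / 4)
              + ereal \<alpha> * (r x\<^sub>0 - (INF y. r y)))
            / ereal (\<alpha> * sqrt (real T + 1))"
proof -
  interpret stochastic_models \<Phi> f r P model \<mu> lip \<L> argmin_model by fact
  let ?n = "real T + 1" and ?b = "\<alpha> * sqrt (real T + 1)"
  define l where "l = \<alpha> / sqrt ?n"
  have n: "1 \<le> sqrt ?n" "0 < ?n" by auto
  have l: "0 < l" "l \<le> \<alpha>" using \<open>\<alpha> > 0\<close> n by (auto simp: l_def divide_le_eq)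
  have b: "0 < ?b" using \<open>\<alpha> > 0\<close> n by simp
  have "l * sqrt ?n = \<alpha>" using n by (simp add: l_def)
  moreover have "?n = sqrt ?n * sqrt ?n" using n by simp
  ultimately have ln: "l * ?n = ?b" "?n * l\<^sup>2 = \<alpha>\<^sup>2"
    using n by (metis mult.assoc, metis mult.commute power2_eq_square power_mult_distrib)
  have x\<^sub>0: "x\<^sub>0 \<in> feasible" by fact
  obtain c\<^sub>0 where c\<^sub>0: "r x\<^sub>0 = ereal c\<^sub>0" using x\<^sub>0 by (blast elim: r_finiteE)
  have min: "objective f r x_star \<le> objective f r y" for y
    using assms(9) by (auto simp: is_arg_min_def not_less)
  have "r x_star \<noteq> \<infinity>" using min[of x\<^sub>0] c\<^sub>0 by (auto simp: objective_def)
  then have star_r: "x_star \<in> edom r" by (simp add: edom_def)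
  then obtain c where c: "r x_star = ereal c" by (blast elim: r_finiteE)
  have obj: "objective f r x_star = ereal (f x_star + finite_part r x_star)"
    using c by (simp add: objective_def)
  \<comment> \<open>Outside this case the bound is infinite.\<close>
  show ?thesis
  proof (cases "x_star \<in> edom \<Phi> \<and> (INF y. r y) \<noteq> -\<infinity>")
    case True
    then have star: "x_star \<in> edom \<Phi>" by simp
    have "(INF y. r y) \<le> r x\<^sub>0" by (rule INF_lower) simp
    with True c\<^sub>0 obtain \<rho> where \<rho>: "(INF y. r y) = ereal \<rho>"
      by (cases "INF y. r y") auto
    then have \<rho>_le: "ereal \<rho> \<le> r y" for y by (metis INF_lower UNIV_I)
    then have \<rho>\<^sub>0: "\<rho> \<le> c\<^sub>0" using c\<^sub>0 by (metis ereal_less_eq(3))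
    let ?D = "real_bregman \<Phi> x_star x\<^sub>0"
    have breg: "bregman \<Phi> x_star x\<^sub>0 = ereal ?D"
      using star x\<^sub>0 int_domD by (intro bregman_eq_real_bregman legendre) auto
    have D: "0 \<le> ?D" using star x\<^sub>0 by (intro real_bregman_nonneg legendre) auto
    let ?B = "(?D + (\<alpha> * \<L>)\<^sup>2 / 4 + \<alpha> * (c\<^sub>0 - \<rho>)) / ?b"
    have "(\<integral>\<^sup>+\<omega>. gap (f x_star + finite_part r x_star) ((1 / ?n) *\<^sub>R (\<Sum>t=0..T. x t \<omega>)) \<partial>M)
        \<le> ennreal ((?D + ?n * (l * \<L>)\<^sup>2 / 4 + l * (finite_part r x\<^sub>0 - \<rho>)) / (l * ?n))"
      by (rule expected_gap_average_le[OF assms(2-4) x\<^sub>0 l(1) _ star star_r min \<rho>_le])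
        (simp add: assms(8) l_def)
    also have "?n * (l * \<L>)\<^sup>2 / 4 = (\<alpha> * \<L>)\<^sup>2 / 4"
      by (simp only: power_mult_distrib mult.assoc[symmetric] ln(2))
    also have "finite_part r x\<^sub>0 = c\<^sub>0" using c\<^sub>0 by simp
    \<comment> \<open>The smaller factor \<open>l\<close> of \<open>r x\<^sub>0 - inf r\<close> is relaxed to \<open>\<alpha>\<close>.\<close>
    also have "ennreal ((?D + (\<alpha> * \<L>)\<^sup>2 / 4 + l * (c\<^sub>0 - \<rho>)) / (l * ?n)) \<le> ennreal ?B"
      unfolding ln(1) using l \<rho>\<^sub>0 b
      by (intro ennreal_leI divide_right_mono add_left_mono mult_right_mono) auto
    finally have "enn2ereal (\<integral>\<^sup>+\<omega>. gap (f x_star + finite_part r x_star) ((1 / ?n) *\<^sub>R (\<Sum>t=0..T. x t \<omega>)) \<partial>M)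
        \<le> enn2ereal (ennreal ?B)"
      by (simp add: less_eq_ennreal.rep_eq)
    also have "\<dots> = ereal ?B"
      using D \<rho>\<^sub>0 b \<open>\<alpha> > 0\<close> by (intro enn2ereal_ennreal divide_nonneg_pos) auto
    also have "ereal ?B = (bregman \<Phi> x_star x\<^sub>0 + ereal ((\<alpha> * \<L>)\<^sup>2 / 4)
        + ereal \<alpha> * (r x\<^sub>0 - (INF y. r y))) / ereal ?b"
      unfolding breg \<rho> c\<^sub>0 using \<open>\<alpha> > 0\<close> n by simp
    finally show ?thesis
      unfolding expectation_nonneg_def obj gap_def[symmetric] .
  next
    case False
    have infinite: "bregman \<Phi> x_star x\<^sub>0 + ereal ((\<alpha> * \<L>)\<^sup>2 / 4) + ereal \<alpha> * (r x\<^sub>0 - (INF y. r y)) = \<infinity>"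
    proof (cases "x_star \<in> edom \<Phi>")
      case False
      then have "bregman \<Phi> x_star x\<^sub>0 = \<infinity>"
        using x\<^sub>0 int_domD by (intro bregman_eq_infinity legendre) auto
      then show ?thesis by simp
    next
      case True
      then have "(INF y. r y) = -\<infinity>" using False by simp
      then show ?thesis using c\<^sub>0 \<open>\<alpha> > 0\<close> by simp
    qed
    show ?thesis unfolding infinite using \<open>\<alpha> > 0\<close> n by (simp add: divide_ereal_def zero_less_mult_iff)
  qed
qed

end
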